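(* Let $G=(V,E)$ be a finite simple undirected graph. For unordered pairs of distinct nodes set $(w^+_{ij},w^-_{ij})=(1,0)$ if $(i,j)\in E$ and $(0,1)$ otherwise. Let $x=(x_{ij})$ be an optimal solution of the linear program $$\min\sum_{(i,j)\in E}x_{ij}\quad\text{s.t. } x_{ij}\le x_{ik}+x_{jk}\ \forall\text{ distinct }i,j,k,\quad x_{ij}\in[0,1]\ \forall (i,j)\in E,\quad x_{ij}=1\ \forall (i,j)\notin E,$$ let $c_{ij}=x_{ij}$ for $(i,j)\in E$ and $c_{ij}=0$ for $(i,j)\notin E$, and let $F^+=\{\{i,j\}:x_{ij}<1/2\}$, $F^-=\{\{i,j\}:x_{ij}\ge1/2\}$. Then, with $\alpha=2$: (i) $w^-_{ij}\le\alpha c_{ij}$ for all $\{i,j\}\in F^+$, and $w^+_{ij}\le\alpha c_{ij}$ for all $\{i,j\}\in F^-$; (ii) for every triple of distinct nodes $i,j,k$ with $\{i,j\},\{j,k\}\in F^+$ and $\{i,k\}\in F^-$, $$w^+_{ij}+w^+_{jk}+w^-_{ik}\le\alpha\,(c_{ij}+c_{jk}+c_{ik}).$$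
   Context: Variables $x_{ij}=x_{ji}$ are indexed by unordered pairs of distinct nodes. The LP is the linear programming relaxation of cluster deletion (partition $V$ into cliques of $G$ minimizing the number of edges between clusters), where $x_{ij}$ is the relaxed indicator that $i$ and $j$ are in different clusters. *)

theory Defs
  imports Complex_Main
begin

text \<open>Unordered pairs of distinct nodes are two-element sets, so a vector indexed by them is a
  function on sets, for which \<open>x\<^sub>i\<^sub>j = x\<^sub>j\<^sub>i\<close> holds because \<open>{i, j} = {j, i}\<close>.
  Only the values on \<open>node_pairs V\<close> are relevant.\<close>

definition node_pairs :: "'a set \<Rightarrow> 'a set set" where
  "node_pairs V = {{i, j} | i j. i \<in> V \<and> j \<in> V \<and> i \<noteq> j}"

definition finite_simple_graph :: "'a set \<Rightarrow> 'a set set \<Rightarrow> bool" where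
  "finite_simple_graph V E \<longleftrightarrow> finite V \<and> E \<subseteq> node_pairs V"

definition w_plus :: "'a set set \<Rightarrow> 'a set \<Rightarrow> real" where
  "w_plus E e = (if e \<in> E then 1 else 0)"

definition w_minus :: "'a set set \<Rightarrow> 'a set \<Rightarrow> real" where
  "w_minus E e = (if e \<in> E then 0 else 1)"

definition lp_objective :: "'a set set \<Rightarrow> ('a set \<Rightarrow> real) \<Rightarrow> real" where
  "lp_objective E x = (\<Sum>e\<in>E. x e)"

definition lp_feasible :: "'a set \<Rightarrow> 'a set set \<Rightarrow> ('a set \<Rightarrow> real) \<Rightarrow> bool" where
  "lp_feasible V E x \<longleftrightarrow>
     (\<forall>i\<in>V. \<forall>j\<in>V. \<forall>k\<in>V. i \<noteq> j \<and> j \<noteq> k \<and> i \<noteq> k \<longrightarrow> x {i, j} \<le> x {i, k} + x {j, k}) \<and>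
     (\<forall>e\<in>E. x e \<in> {0..1}) \<and>
     (\<forall>e\<in>node_pairs V - E. x e = 1)"

definition lp_optimal :: "'a set \<Rightarrow> 'a set set \<Rightarrow> ('a set \<Rightarrow> real) \<Rightarrow> bool" where
  "lp_optimal V E x \<longleftrightarrow> is_arg_min (lp_objective E) (lp_feasible V E) x"

definition lp_cost :: "'a set set \<Rightarrow> ('a set \<Rightarrow> real) \<Rightarrow> 'a set \<Rightarrow> real" where
  "lp_cost E x e = (if e \<in> E then x e else 0)"

definition F_plus :: "'a set \<Rightarrow> ('a set \<Rightarrow> real) \<Rightarrow> 'a set set" where
  "F_plus V x = {e \<in> node_pairs V. x e < 1 / 2}"

definition F_minus :: "'a set \<Rightarrow> ('a set \<Rightarrow> real) \<Rightarrow> 'a set set" where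
  "F_minus V x = {e \<in> node_pairs V. x e \<ge> 1 / 2}"

end

theory Submission
  imports Defs
begin

text \<open>Pairs in \<open>F\<^sup>+\<close> are edges because non-edges have value 1, which gives (i). In (ii), if \<open>{i, k}\<close> were
  a non-edge, the triangle inequality would read \<open>1 \<le> x\<^sub>i\<^sub>j + x\<^sub>j\<^sub>k < 1\<close>. Hence all three pairs are edges
  and \<open>x\<^sub>i\<^sub>j + x\<^sub>j\<^sub>k + x\<^sub>i\<^sub>k \<ge> 2 x\<^sub>i\<^sub>k \<ge> 1\<close>.\<close>

lemma F_plus_subset_edges:
  assumes "lp_feasible V E x"
  shows "F_plus V x \<subseteq> E"
  using assms unfolding lp_feasible_def F_plus_def by force

theorem theorem6:
  fixes V :: "'a set" and E :: "'a set set" and x :: "'a set \<Rightarrow> real" and \<alpha> :: real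
  assumes "finite_simple_graph V E"
    and "lp_optimal V E x"
    and "\<alpha> = 2"
  shows "(\<forall>e\<in>F_plus V x. w_minus E e \<le> \<alpha> * lp_cost E x e) \<and>
         (\<forall>e\<in>F_minus V x. w_plus E e \<le> \<alpha> * lp_cost E x e) \<and>
         (\<forall>i\<in>V. \<forall>j\<in>V. \<forall>k\<in>V.
            i \<noteq> j \<and> j \<noteq> k \<and> i \<noteq> k \<and>
            {i, j} \<in> F_plus V x \<and> {j, k} \<in> F_plus V x \<and> {i, k} \<in> F_minus V x \<longrightarrow>
            w_plus E {i, j} + w_plus E {j, k} + w_minus E {i, k}
              \<le> \<alpha> * (lp_cost E x {i, j} + lp_cost E x {j, k} + lp_cost E x {i, k}))"
proof -
  have feas: "lp_feasible V E x"
    using assms(2) by (simp add: lp_optimal_def is_arg_min_def)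
  have nonedge: "x e = 1" if "e \<in> node_pairs V" "e \<notin> E" for e
    using feas that by (auto simp: lp_feasible_def)
  have "w_plus E {i, j} + w_plus E {j, k} + w_minus E {i, k}
      \<le> \<alpha> * (lp_cost E x {i, j} + lp_cost E x {j, k} + lp_cost E x {i, k})"
    if V: "i \<in> V" "j \<in> V" "k \<in> V" and ne: "i \<noteq> j" "j \<noteq> k" "i \<noteq> k"
      and F: "{i, j} \<in> F_plus V x" "{j, k} \<in> F_plus V x" "{i, k} \<in> F_minus V x" for i j k
  proof -
    have tri: "x {i, k} \<le> x {i, j} + x {j, k}"
    proof -
      \<comment> \<open>This is the triangle constraint for the pair \<open>{i, k}\<close> with
        \<open>j\<close> as the third node. It yields the last pair as \<open>{k, j}\<close>, which
        is then reordered to match the assumption on \<open>{j, k}\<close>.\<close>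
      have "x {i, k} \<le> x {i, j} + x {k, j}"
        using feas V ne unfolding lp_feasible_def by simp
      then show ?thesis
        by (simp only: insert_commute[of k j])
    qed
    have lt: "x {i, j} < 1 / 2" "x {j, k} < 1 / 2"
      using F by (auto simp: F_plus_def)
    have ge: "x {i, k} \<ge> 1 / 2" and pair: "{i, k} \<in> node_pairs V"
      using F(3) by (auto simp: F_minus_def)
    have "{i, k} \<in> E"
      using nonedge[OF pair] tri lt by linarith
    moreover have "{i, j} \<in> E" "{j, k} \<in> E"
      using F_plus_subset_edges[OF feas] F by auto
    ultimately show ?thesis
      using tri ge assms(3) by (simp add: w_plus_def w_minus_def lp_cost_def)
  qed
  \<comment> \<open>On an edge \<open>w_minus\<close> is 0, so the bound is just the constraint
    \<open>x e \<ge> 0\<close>.\<close>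
  moreover have "\<forall>e\<in>F_plus V x. w_minus E e \<le> \<alpha> * lp_cost E x e"
    using F_plus_subset_edges[OF feas] feas assms(3)
    by (auto simp: lp_feasible_def w_minus_def lp_cost_def)
  \<comment> \<open>For an edge, the threshold 1/2 gives \<open>1 \<le> 2 * x e\<close>; for a
    non-edge both sides are 0, since \<open>lp_cost\<close> vanishes there even though
    \<open>x e = 1\<close>.\<close>
  moreover have "\<forall>e\<in>F_minus V x. w_plus E e \<le> \<alpha> * lp_cost E x e"
    using assms(3) by (auto simp: F_minus_def w_plus_def lp_cost_def)
  ultimately show ?thesis
    by blast
qed

end
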